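(* Let $G_{\mathbb{C}}=SL(2,\mathbb{C})$ and $K_{\mathbb{C}}=SO(2,\mathbb{C})$. Then: (1) The $K_{\mathbb{C}}$-double coset decomposition of $G_{\mathbb{C}}$ is given by the disjoint union (of $K_{\mathbb{C}}$-bi-invariant subsets) $$G_{\mathbb{C}}=K_{\mathbb{C}}A_{\mathbb{C}}'K_{\mathbb{C}}\ \amalg\ P^{-'}K_{\mathbb{C}}\ \amalg\ P^{+'}K_{\mathbb{C}}\ \amalg\ P^{-'}y_0K_{\mathbb{C}}\ \amalg\ P^{+'}y_0K_{\mathbb{C}}\ \amalg\ K_{\mathbb{C}}.$$ (2) The following equality holds, the union on the right being disjoint: $$\tilde\Xi\setminus K_{\mathbb{C}}A_{\mathbb{C}}K_{\mathbb{C}}=P^-_{1/2}K_{\mathbb{C}}\ \amalg\ P^+_{1/2}K_{\mathbb{C}}.$$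
   Context: $G=SL(2,\mathbb{R})\subseteq G_{\mathbb{C}}=SL(2,\mathbb{C})$, $K_{\mathbb{C}}=SO(2,\mathbb{C})$, $A_{\mathbb{C}}=\{\mathrm{diag}(z,z^{-1}): z\in\mathbb{C}^*\}$, $A_{\mathbb{C}}'=A_{\mathbb{C}}\setminus\{\pm\mathbf{1}\}$. The subgroups $P^\mp$ of $G_{\mathbb{C}}$ are $$P^-=\left\{\begin{pmatrix} 1-u & i u \\ i u & 1+u \end{pmatrix}: u\in\mathbb{C}\right\},\qquad P^+=\left\{\begin{pmatrix} 1+u & i u \\ i u & 1-u \end{pmatrix}: u\in\mathbb{C}\right\},$$ and $P^{\mp'}=P^\mp\setminus\{\mathbf{1}\}$. The punctured discs are $$P^-_{1/2}=\left\{\begin{pmatrix} 1-v & i v \\ i v & 1+v \end{pmatrix}: v\in\mathbb{C},\ 0<|v|<\tfrac12\right\},\qquad P^+_{1/2}=\left\{\begin{pmatrix} 1+v & i v \\ i v & 1-v \end{pmatrix}: v\in\mathbb{C},\ 0<|v|<\tfrac12\right\}.$$ Further, $y_0=\mathrm{diag}(i,-i)$. With $\mathfrak{a}=\{\mathrm{diag}(t,-t): t\in\mathbb{R}\}$ and $\Omega=\{\mathrm{diag}(t,-t): |t|<\pi/4\}$ (that is, $\Omega=\{X\in\mathfrak{a}:|\alpha(X)|<\pi/2\}$ for the roots $\pm\alpha$, $\alpha(\mathrm{diag}(t,-t))=2t$), set $\tilde\Xi=G\exp(i\Omega)K_{\mathbb{C}}\subseteq G_{\mathbb{C}}$. *)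

theory Defs
  imports "HOL-Analysis.Analysis"
begin

type_synonym cmat = "complex^2^2"

definition mat2 :: "'a::zero \<Rightarrow> 'a \<Rightarrow> 'a \<Rightarrow> 'a \<Rightarrow> 'a^2^2" where
  "mat2 a b c d = vector [vector [a, b], vector [c, d]]"

definition diag2 :: "'a::zero \<Rightarrow> 'a \<Rightarrow> 'a^2^2" where
  "diag2 a d = mat2 a 0 0 d"

definition set_mult :: "cmat set \<Rightarrow> cmat set \<Rightarrow> cmat set" (infixl "\<otimes>\<^sub>S" 70) where
  "A \<otimes>\<^sub>S B = {a ** b | a b. a \<in> A \<and> b \<in> B}"

(* The type complex^2^2 carries no ring structure in HOL-Analysis, so the overloaded
   constants power and exp are not available on it. *)
primrec mat_power :: "cmat \<Rightarrow> nat \<Rightarrow> cmat" where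
  "mat_power X 0 = mat 1"
| "mat_power X (Suc n) = X ** mat_power X n"

definition mat_exp :: "cmat \<Rightarrow> cmat" where
  "mat_exp X = (\<Sum>n. mat_power X n /\<^sub>R fact n)"

definition SL2C :: "cmat set" where
  "SL2C = {g. det g = 1}"

definition SL2R :: "cmat set" where
  "SL2R = map_matrix complex_of_real ` {g :: real^2^2. det g = 1}"

(* orthogonal_matrix is defined through the transpose, without complex conjugation. *)
definition K_C :: "cmat set" where
  "K_C = {k. orthogonal_matrix k \<and> det k = 1}"

definition A_C :: "cmat set" where
  "A_C = {diag2 z (inverse z) | z. z \<noteq> 0}"

definition A_C' :: "cmat set" where
  "A_C' = A_C - {mat 1, - mat 1}"

definition p_minus :: "complex \<Rightarrow> cmat" where
  "p_minus u = mat2 (1 - u) (\<i> * u) (\<i> * u) (1 + u)"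

definition p_plus :: "complex \<Rightarrow> cmat" where
  "p_plus u = mat2 (1 + u) (\<i> * u) (\<i> * u) (1 - u)"

definition P_minus :: "cmat set" where
  "P_minus = range p_minus"

definition P_plus :: "cmat set" where
  "P_plus = range p_plus"

definition P_minus' :: "cmat set" where
  "P_minus' = P_minus - {mat 1}"

definition P_plus' :: "cmat set" where
  "P_plus' = P_plus - {mat 1}"

definition P_minus_half :: "cmat set" where
  "P_minus_half = {p_minus v | v. 0 < norm v \<and> norm v < 1/2}"

definition P_plus_half :: "cmat set" where
  "P_plus_half = {p_plus v | v. 0 < norm v \<and> norm v < 1/2}"

definition y0 :: cmat where
  "y0 = diag2 \<i> (- \<i>)"

definition Omega :: "cmat set" where
  "Omega = {diag2 (complex_of_real t) (- complex_of_real t) | t :: real. \<bar>t\<bar> < pi/4}"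

definition exp_i_Omega :: "cmat set" where
  "exp_i_Omega = {mat_exp (map_matrix ((*) \<i>) X) | X. X \<in> Omega}"

definition Xi_tilde :: "cmat set" where
  "Xi_tilde = SL2R \<otimes>\<^sub>S exp_i_Omega \<otimes>\<^sub>S K_C"

definition K_biinvariant :: "cmat set \<Rightarrow> bool" where
  "K_biinvariant S \<longleftrightarrow> K_C \<otimes>\<^sub>S S \<otimes>\<^sub>S K_C = S"

(* A list rather than a set of sets, so that disjointness also separates
   entries that might coincide as sets. *)
definition is_disjoint_union :: "'a set \<Rightarrow> 'a set list \<Rightarrow> bool" where
  "is_disjoint_union S Xs \<longleftrightarrow>
     S = \<Union>(set Xs) \<and> disjoint_family_on (\<lambda>i. Xs ! i) {..<length Xs}"

end

theory Submission
  imports Defs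
begin

text \<open>
  The map sending g to g times its transpose is injective on cosets of \<^term>\<open>K_C\<close> and carries
  left multiplication by \<^term>\<open>K_C\<close> to conjugation, so it turns double cosets into
  \<^term>\<open>K_C\<close>-conjugacy classes of symmetric matrices S of determinant 1. If the trace of S is not
  2 or -2, then S is conjugate to a diagonal matrix; if it is, then S or -S is unipotent and, being
  symmetric, is one of the matrices in \<^term>\<open>P_minus\<close> or \<^term>\<open>P_plus\<close>.

  For g in \<^term>\<open>Xi_tilde\<close> the real part of S is positive definite. This excludes trace -2, and for
  the element of \<^term>\<open>P_minus\<close> or \<^term>\<open>P_plus\<close> with parameter 2v the determinant of the real
  part is 1 - 4|v|^2, whence |v| < 1/2. Conversely such an S is rotated to a real parameter, where
  its real and imaginary parts are diagonalized simultaneously by an explicit real congruence.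
\<close>

section \<open>Two-by-two matrices and the group \<open>K_C\<close>\<close>

lemma mat2_nth [simp]:
  "mat2 a b c d $ 1 $ 1 = a" "mat2 a b c d $ 1 $ 2 = b"
  "mat2 a b c d $ 2 $ 1 = c" "mat2 a b c d $ 2 $ 2 = d"
  by (simp_all add: mat2_def)

lemma mat2_cases: obtains a b c d where "X = mat2 a b c d"
  using that[of "X$1$1" "X$1$2" "X$2$1" "X$2$2"] by (simp add: vec_eq_iff forall_2)

lemma mat2_eq_iff [simp]:
  "mat2 a b c d = mat2 a' b' c' d' \<longleftrightarrow> a = a' \<and> b = b' \<and> c = c' \<and> d = d'"
  by (auto simp: vec_eq_iff forall_2)

lemma mat2_mult:
  fixes a b c d :: "'a::semiring_1"
  shows "mat2 a b c d ** mat2 a' b' c' d' =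
    mat2 (a*a' + b*c') (a*b' + b*d') (c*a' + d*c') (c*b' + d*d')"
  by (simp add: vec_eq_iff forall_2 matrix_matrix_mult_def sum_2)

lemma transpose_mat2 [simp]: "transpose (mat2 a b c d) = mat2 a c b d"
  by (simp add: vec_eq_iff forall_2 transpose_def)

lemma det_mat2 [simp]: "det (mat2 a b c d) = a * d - b * c"
  by (simp add: det_2)

lemma mat_1_mat2: "mat 1 = mat2 1 0 0 1"
  by (simp add: vec_eq_iff forall_2 mat_def)

lemma uminus_mat2 [simp]:
  fixes a b c d :: "'a::group_add"
  shows "- mat2 a b c d = mat2 (-a) (-b) (-c) (-d)"
  by (simp add: vec_eq_iff forall_2)

lemma map_matrix_mat2 [simp]: "map_matrix f (mat2 a b c d) = mat2 (f a) (f b) (f c) (f d)"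
  by (simp add: vec_eq_iff forall_2 map_matrix_def)

lemma orthogonal_matrix_field:
  fixes Q :: "'a::field^'n^'n"
  shows "orthogonal_matrix Q \<longleftrightarrow> transpose Q ** Q = mat 1"
  using matrix_left_right_inverse orthogonal_matrix_def by blast

lemma orthogonal_matrix_mul_field:
  fixes A B :: "'a::field^'n^'n"
  assumes "orthogonal_matrix A" "orthogonal_matrix B"
  shows "orthogonal_matrix (A ** B)"
proof -
  have "transpose (A ** B) ** (A ** B) = transpose B ** (transpose A ** A) ** B"
    by (simp add: matrix_transpose_mul matrix_mul_assoc)
  then show ?thesis using assms by (simp add: orthogonal_matrix_field)
qed

text \<open>At determinant 1 the inverse is the adjugate, and comparing it with the transpose forces
  \<open>d = a\<close> and \<open>c = -b\<close>.\<close>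

lemma K_C_iff: "k \<in> K_C \<longleftrightarrow> (\<exists>c s. k = mat2 c s (-s) c \<and> c\<^sup>2 + s\<^sup>2 = 1)"
proof
  assume "k \<in> K_C"
  obtain a b c d where k: "k = mat2 a b c d" by (rule mat2_cases)
  have h: "a * a + c * c = 1" "a * b + c * d = 0" "a * d - b * c = 1"
    using \<open>k \<in> K_C\<close> by (auto simp: K_C_def orthogonal_matrix_field k mat2_mult mat_1_mat2)
  have "d = a" "c = -b" using h by algebra+
  then show "\<exists>c s. k = mat2 c s (-s) c \<and> c\<^sup>2 + s\<^sup>2 = 1"
    using h by (intro exI[of _ a] exI[of _ b]) (simp add: k power2_eq_square)
qed (auto simp: K_C_def orthogonal_matrix_field mat2_mult mat_1_mat2 power2_eq_square algebra_simps)

lemma K_C_mult: "k \<in> K_C \<Longrightarrow> l \<in> K_C \<Longrightarrow> k ** l \<in> K_C"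
  by (simp add: K_C_def orthogonal_matrix_mul_field det_mul)

lemma one_in_K_C: "mat 1 \<in> K_C"
  by (simp add: K_C_def orthogonal_matrix_id)

lemma K_C_transpose: "k \<in> K_C \<Longrightarrow> transpose k \<in> K_C"
  by (simp add: K_C_def orthogonal_matrix_transpose)

lemma K_C_mult_transpose: "k \<in> K_C \<Longrightarrow> k ** transpose k = mat 1"
  by (simp add: K_C_def orthogonal_matrix_def)

lemma K_C_det: "k \<in> K_C \<Longrightarrow> det k = 1"
  by (simp add: K_C_def)

lemma set_mult_iff: "x \<in> A \<otimes>\<^sub>S B \<longleftrightarrow> (\<exists>a\<in>A. \<exists>b\<in>B. x = a ** b)"
  by (auto simp: set_mult_def)

lemma set_mult3_iff: "x \<in> A \<otimes>\<^sub>S B \<otimes>\<^sub>S C \<longleftrightarrow> (\<exists>a\<in>A. \<exists>b\<in>B. \<exists>c\<in>C. x = a ** b ** c)"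
  by (force simp: set_mult_def)

section \<open>Cosets and the Gram matrix\<close>

definition gram :: "cmat \<Rightarrow> cmat" where
  "gram g = g ** transpose g"

lemma gram_mat2: "gram (mat2 a b c d) =
    mat2 (a*a + b*b) (a*c + b*d) (a*c + b*d) (c*c + d*d)"
  by (simp add: gram_def mat2_mult algebra_simps)

lemma gram_mult: "gram (a ** b) = a ** gram b ** transpose a"
  by (simp add: gram_def matrix_transpose_mul matrix_mul_assoc)

lemma gram_mult_K_C: "k \<in> K_C \<Longrightarrow> gram (g ** k) = gram g"
  by (simp add: gram_mult gram_def[of k] K_C_mult_transpose) (simp add: gram_def)

text \<open>With \<open>r\<close> the inverse of \<open>s\<close>, the Gram matrix of
  \<open>r ** g\<close> equals that of \<open>r ** s\<close>, which is 1, so \<open>r ** g\<close>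
  is orthogonal.\<close>

lemma gram_eq_imp_coset:
  assumes "det s = 1" "det g = 1" "gram g = gram s"
  shows "\<exists>k\<in>K_C. g = s ** k"
proof -
  have "invertible s" using assms by (simp add: invertible_det_nz)
  then obtain r where r: "s ** r = mat 1" "r ** s = mat 1" by (auto simp: invertible_def)
  let ?k = "r ** g"
  have "gram ?k = gram (r ** s)" using assms by (simp add: gram_mult)
  then have "?k ** transpose ?k = mat 1" by (simp add: r) (simp add: gram_def)
  then have "orthogonal_matrix ?k"
    unfolding orthogonal_matrix_def using matrix_left_right_inverse by blast
  moreover have "det r = 1" using arg_cong[OF r(1), of det] assms by (simp add: det_mul)
  ultimately have "?k \<in> K_C" using assms by (simp add: K_C_def det_mul)
  moreover have "g = s ** ?k" by (simp add: matrix_mul_assoc r)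
  ultimately show ?thesis by blast
qed

text \<open>Treats \<^const>\<open>p_minus\<close> (e = -1) and \<^const>\<open>p_plus\<close> (e = 1) simultaneously.\<close>
definition p_sgn :: "complex \<Rightarrow> complex \<Rightarrow> cmat" where
  "p_sgn e u = mat2 (1 + e * u) (\<i> * u) (\<i> * u) (1 - e * u)"

lemma p_minus_eq: "p_minus u = p_sgn (-1) u" and p_plus_eq: "p_plus u = p_sgn 1 u"
  by (simp_all add: p_minus_def p_plus_def p_sgn_def)

lemma p_sgn_eq_1_iff: "p_sgn e u = mat 1 \<longleftrightarrow> u = 0"
  by (auto simp: p_sgn_def mat_1_mat2)

lemma P_minus'_eq: "P_minus' = p_sgn (-1) ` (- {0})"
  and P_plus'_eq: "P_plus' = p_sgn 1 ` (- {0})"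
  by (auto simp: P_minus'_def P_minus_def P_plus'_def P_plus_def p_minus_eq p_plus_eq p_sgn_eq_1_iff)

lemma P_half_eq:
  "P_minus_half = p_sgn (-1) ` {v. 0 < norm v \<and> norm v < 1/2}"
  "P_plus_half = p_sgn 1 ` {v. 0 < norm v \<and> norm v < 1/2}"
  by (auto simp: P_minus_half_def P_plus_half_def p_minus_eq p_plus_eq)

lemma det_p_sgn: "e * e = 1 \<Longrightarrow> det (p_sgn e u) = 1"
  by (simp add: p_sgn_def algebra_simps)

text \<open>\<open>p_sgn e u\<close> is symmetric and has the form 1 + u N with N N = 0 when
  \<open>e * e = 1\<close>, so its Gram matrix is its square 1 + 2 u N.\<close>

lemma gram_p_sgn: "e * e = 1 \<Longrightarrow> gram (p_sgn e u) = p_sgn e (2 * u)"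
  by (simp add: p_sgn_def gram_mat2) (simp add: algebra_simps)

lemma y0_mat2: "y0 = mat2 \<i> 0 0 (-\<i>)"
  by (simp add: y0_def diag2_def)

text \<open>\<open>y0\<close> times its transpose is -1, so inserting \<open>y0\<close> only flips
  the sign.\<close>

lemma gram_p_sgn_y0: "e * e = 1 \<Longrightarrow> gram (p_sgn e u ** y0) = - p_sgn e (2 * u)"
  by (simp add: p_sgn_def gram_mat2 mat2_mult y0_mat2) (simp add: algebra_simps)

text \<open>Reduces membership in a union of cosets to an equation between Gram matrices;
  determinant 1 is what \<open>gram_eq_imp_coset\<close> needs.\<close>

lemma coset_iff_gram:
  assumes "\<And>s. s \<in> S \<Longrightarrow> det s = 1"
  shows "g \<in> S \<otimes>\<^sub>S K_C \<longleftrightarrow> det g = 1 \<and> (\<exists>s\<in>S. gram g = gram s)"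
proof
  assume "g \<in> S \<otimes>\<^sub>S K_C"
  then obtain s k where "s \<in> S" "k \<in> K_C" "g = s ** k" by (auto simp: set_mult_iff)
  then show "det g = 1 \<and> (\<exists>s\<in>S. gram g = gram s)"
    using assms by (auto simp: gram_mult_K_C det_mul K_C_det)
next
  assume "det g = 1 \<and> (\<exists>s\<in>S. gram g = gram s)"
  then show "g \<in> S \<otimes>\<^sub>S K_C"
    using assms gram_eq_imp_coset unfolding set_mult_iff by blast
qed

lemma P_coset_iff:
  assumes "e * e = 1"
  shows "g \<in> p_sgn e ` U \<otimes>\<^sub>S K_C \<longleftrightarrow> det g = 1 \<and> (\<exists>u\<in>U. gram g = p_sgn e (2 * u))"
  using assms by (subst coset_iff_gram) (auto simp: det_p_sgn gram_p_sgn)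

lemma P_y0_coset_iff:
  assumes "e * e = 1"
  shows "g \<in> p_sgn e ` U \<otimes>\<^sub>S {y0} \<otimes>\<^sub>S K_C
    \<longleftrightarrow> det g = 1 \<and> (\<exists>u\<in>U. gram g = - p_sgn e (2 * u))"
proof -
  have "p_sgn e ` U \<otimes>\<^sub>S {y0} = (\<lambda>u. p_sgn e u ** y0) ` U"
    by (auto simp: set_mult_iff)
  moreover have "det y0 = 1" by (simp add: y0_mat2)
  ultimately show ?thesis
    using assms by simp (subst coset_iff_gram; auto simp: det_mul det_p_sgn gram_p_sgn_y0)
qed

lemma A_C_mat2: "A_C = {mat2 z 0 0 (inverse z) | z. z \<noteq> 0}"
  by (simp add: A_C_def diag2_def)

section \<open>Normal forms of symmetric matrices of determinant 1\<close>

text \<open>After subtraction of the scalar \<open>t\<close> the matrix is traceless with entries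
  \<open>h\<close> and \<open>b\<close>, and its square is the scalar \<open>q * q\<close>, nonzero
  because the trace is not 2 or -2. The eigenvalues are thus \<open>t + q\<close> and
  \<open>t - q\<close>, with product 1, and a complex rotation diagonalizes the matrix;
  \<open>z\<close> is a square root of \<open>t + q\<close>.\<close>

lemma diagonalize_symmetric:
  fixes a b d :: complex
  assumes "a * d - b * b = 1" "(a + d)\<^sup>2 \<noteq> 4"
  shows "\<exists>k\<in>K_C. \<exists>z. z \<noteq> 0 \<and> mat2 a b b d = gram (k ** mat2 z 0 0 (inverse z))"
proof -
  define t where "t = (a + d) / 2"
  define h where "h = (a - d) / 2"
  define q where "q = csqrt (t\<^sup>2 - 1)"
  have ad: "a = t + h" "d = t - h" by (simp_all add: t_def h_def field_simps)
  have q2: "q * q = t * t - 1" by (simp add: q_def flip: power2_eq_square)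
  have hb: "h * h + b * b = q * q" using assms(1) by (simp add: q2 ad algebra_simps)
  have q0: "q \<noteq> 0"
  proof
    assume "q = 0"
    then have "t * t = 1" using q2 by simp
    then show False using assms(2) by (simp add: ad power2_eq_square algebra_simps)
  qed
  define w where "w = t + q"
  have ww: "(t + q) * (t - q) = 1" using q2 by (simp add: algebra_simps)
  then have w0: "w \<noteq> 0" by (auto simp: w_def)
  have iw: "inverse w = t - q" using ww by (simp add: w_def inverse_unique)
  define z where "z = csqrt w"
  have zz: "z * z = w" by (simp add: z_def flip: power2_eq_square)
  then have z0: "z \<noteq> 0" using w0 by auto
  have "inverse z * inverse z = inverse w" by (simp add: zz[symmetric])
  with iw have izz: "inverse z * inverse z = t - q" by simp
  \<comment> \<open>By \<open>hb\<close>, h/q and -b/q are the cosine and sine of a complex angle;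
    \<open>c\<close> and \<open>s\<close> belong to half that angle.\<close>
  obtain c s where cs: "c * c + s * s = 1" "(c * c - s * s) * q = h" "2 * c * s * q = - b"
  proof -
    define c where "c = csqrt ((1 + h / q) / 2)"
    have cc: "c * c = (1 + h / q) / 2" by (simp add: c_def flip: power2_eq_square)
    show thesis
    proof (cases "c = 0")
      \<comment> \<open>Dividing by \<open>c\<close> is impossible here, but \<open>h = - q\<close>
        forces \<open>b = 0\<close>, and a quarter turn exchanges the two eigenvalues.\<close>
      case True
      then have "h = - q" using cc q0 by (simp add: field_simps add_eq_0_iff)
      then show thesis using hb that[of 0 1] by simp
    next
      case False
      define s where "s = - b / (2 * q * c)"
      have "s * s * (4 * (q * q) * (c * c)) = b * b"
        using False q0 by (simp add: s_def field_simps)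
      also have "b * b = (q - h) * (q + h)" using hb by (simp add: algebra_simps)
      also have "q + h = 2 * q * (c * c)" using q0 by (simp add: cc field_simps)
      finally have "s * s * (2 * q) * (2 * q * (c * c)) = (q - h) * (2 * q * (c * c))"
        by (simp add: algebra_simps)
      then have "s * s * (2 * q) = q - h"
        by (subst (asm) mult_right_cancel) (use False q0 in auto)
      then have ss: "s * s = (1 - h / q) / 2" using q0 by (simp add: field_simps)
      show thesis
      proof (rule that[of c s])
        show "c * c + s * s = 1" by (simp add: cc ss field_simps)
        show "(c * c - s * s) * q = h" using q0 by (simp add: cc ss field_simps)
        show "2 * c * s * q = - b" using q0 False by (simp add: s_def)
      qed
    qed
  qed
  have "mat2 c s (-s) c \<in> K_C" using cs(1) by (auto simp: K_C_iff power2_eq_square)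
  moreover have "mat2 a b b d = gram (mat2 c s (-s) c ** mat2 z 0 0 (inverse z))"
  proof -
    have "gram (mat2 c s (-s) c ** mat2 z 0 0 (inverse z)) =
      mat2 ((c*c)*(z*z) + (s * s)*(inverse z*inverse z)) (c * s * (inverse z*inverse z) - c * s * (z*z))
        (c * s * (inverse z*inverse z) - c * s * (z*z)) ((s * s)*(z*z) + (c*c)*(inverse z*inverse z))"
      by (simp add: mat2_mult gram_mat2 algebra_simps)
    also have "\<dots> = mat2 ((c * c + s * s)*t + (c * c - s * s)*q) (-(2 * c * s * q)) (-(2 * c * s * q))
        ((c * c + s * s)*t - (c * c - s * s)*q)"
      unfolding zz izz w_def by (simp add: algebra_simps)
    finally show ?thesis by (simp only: cs) (simp add: ad)
  qed
  ultimately show ?thesis using z0 by blast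
qed

text \<open>The trace gives \<open>t\<close> = 1 or -1, and the determinant then reads h h + b b =
  0, which factors over the complex numbers. The vanishing factor selects \<open>e\<close>, and
  \<open>t\<close> selects the sign in front of \<open>p_sgn\<close>.\<close>

lemma symmetric_trace_cases:
  fixes a b d :: complex
  assumes "a * d - b * b = 1" "(a + d)\<^sup>2 = 4"
  shows "\<exists>e\<in>{1,-1}. \<exists>u. mat2 a b b d = p_sgn e (2*u) \<or> mat2 a b b d = - p_sgn e (2*u)"
proof -
  define h where "h = (a - d) / 2"
  define t where "t = (a + d) / 2"
  have ad: "a = t + h" "d = t - h" by (simp_all add: t_def h_def field_simps)
  have "t\<^sup>2 = 1" using assms(2) by (simp add: t_def power_divide)
  then have t: "t \<in> {1,-1}" "a = t + h" "d = t - h" using ad by (auto simp: power2_eq_1_iff)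
  have "(h - \<i> * b) * (h + \<i> * b) = 0" using assms(1) t by (auto simp: algebra_simps)
  then consider (3) "h = \<i> * b" | (4) "h = - \<i> * b" by (auto simp: add_eq_0_iff2)
  then obtain e where e: "e \<in> {1,-1}" "h = - e * \<i> * b"
  proof cases
    case 3 then show thesis by (intro that[of "-1"]) auto
  next
    case 4 then show thesis by (intro that[of 1]) auto
  qed
  show ?thesis
  \<comment> \<open>The witness is read off the off-diagonal entry, where
    \<open>\<i> * (2 * u)\<close> must equal \<open>t * b\<close>.\<close>
  proof (intro bexI[of _ e] exI[of _ "- t * \<i> * b / 2"])
    show "mat2 a b b d = p_sgn e (2 * (- t * \<i> * b / 2)) \<or>
        mat2 a b b d = - p_sgn e (2 * (- t * \<i> * b / 2))"
      using t(1) e(1) by (auto simp: t(2,3) e(2) p_sgn_def)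
  qed (fact e)
qed

section \<open>Double cosets through \<open>A_C\<close>\<close>

lemma trace_mat2: "trace (mat2 a b c d) = a + d"
  by (simp add: trace_def sum_2)

lemma trace_conj_K_C:
  assumes "k \<in> K_C"
  shows "trace (k ** X ** transpose k) = trace X"
proof -
  have "trace (k ** X ** transpose k) = trace (transpose k ** (k ** X))" by (rule trace_mul_sym)
  also have "\<dots> = trace X"
    using assms by (simp add: matrix_mul_assoc K_C_def orthogonal_matrix_def)
  finally show ?thesis .
qed

lemma gram_conj_K_C:
  assumes "k \<in> K_C" "l \<in> K_C"
  shows "gram (k ** a ** l) = k ** gram a ** transpose k"
  using assms by (simp add: gram_mult_K_C) (simp add: gram_mult)

text \<open>The Gram matrix is conjugate to diag(w, 1/w), and trace 2 or -2 forces \<open>w\<close>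
  to be 1 or -1, hence a scalar matrix. Nontrivial unipotent matrices and their negatives are
  thereby excluded.\<close>

lemma KAK_gram:
  assumes "g \<in> K_C \<otimes>\<^sub>S A_C \<otimes>\<^sub>S K_C"
  shows "det g = 1" "trace (gram g) = 2 \<Longrightarrow> gram g = mat 1"
    "trace (gram g) = - 2 \<Longrightarrow> gram g = - mat 1"
proof -
  obtain k l z where k: "k \<in> K_C" "l \<in> K_C" and z: "z \<noteq> 0"
    and g: "g = k ** mat2 z 0 0 (inverse z) ** l"
    using assms by (auto simp: set_mult3_iff A_C_mat2)
  show "det g = 1" using k z by (simp add: g det_mul K_C_det)
  define w where "w = z * z"
  have w: "w \<noteq> 0" using z by (simp add: w_def)
  have G: "gram g = k ** mat2 w 0 0 (inverse w) ** transpose k"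
    using k by (simp add: g gram_conj_K_C gram_mat2 w_def)
  then have tr: "trace (gram g) = w + inverse w"
    using k by (simp add: trace_conj_K_C trace_mat2)
  show "gram g = mat 1" if "trace (gram g) = 2"
  proof -
    have "(w - 1) * (w - 1) = 0" using that w unfolding tr by (simp add: field_simps)
    then have "w = 1" by simp
    then show ?thesis using k by (simp add: G K_C_mult_transpose flip: mat_1_mat2)
  qed
  show "gram g = - mat 1" if "trace (gram g) = -2"
  proof -
    have "w + inverse w = - 2" using that by (simp add: tr)
    moreover have "w * inverse w = 1" using w by simp
    ultimately have "(w + 1) * (w + 1) = 0" by algebra
    then have "w = -1" by (simp add: add_eq_0_iff2)
    moreover obtain c s where "k = mat2 c s (-s) c" "c\<^sup>2 + s\<^sup>2 = 1" using k K_C_iff by blast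
    ultimately show ?thesis
      by (simp add: G mat2_mult mat_1_mat2) (simp add: algebra_simps power2_eq_square)
  qed
qed

text \<open>\<open>A_C\<close> meets \<open>K_C\<close> exactly in 1 and -1, and outer factors from
  \<open>K_C\<close> do not affect membership in \<open>K_C\<close>.\<close>

lemma KA'K_eq: "K_C \<otimes>\<^sub>S A_C' \<otimes>\<^sub>S K_C = K_C \<otimes>\<^sub>S A_C \<otimes>\<^sub>S K_C - K_C"
proof (intro set_eqI iffI)
  fix g assume "g \<in> K_C \<otimes>\<^sub>S A_C' \<otimes>\<^sub>S K_C"
  then obtain k a l where g: "k \<in> K_C" "l \<in> K_C" "a \<in> A_C'" "g = k ** a ** l"
    by (auto simp: set_mult3_iff)
  have "a \<in> A_C" using g by (simp add: A_C'_def)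
  then have "g \<in> K_C \<otimes>\<^sub>S A_C \<otimes>\<^sub>S K_C" using g by (auto simp: set_mult3_iff)
  moreover have "g \<notin> K_C"
  proof
    assume "g \<in> K_C"
    have "transpose k ** g ** transpose l = (transpose k ** k) ** a ** (l ** transpose l)"
      by (simp add: g matrix_mul_assoc)
    also have "\<dots> = a" using g K_C_mult_transpose[of "transpose k"]
      by (simp add: K_C_mult_transpose K_C_transpose)
    finally have "a \<in> K_C" using g \<open>g \<in> K_C\<close> by (metis K_C_mult K_C_transpose)
    then obtain z where "z \<noteq> 0" "a = mat2 z 0 0 z" "z\<^sup>2 = 1"
      using \<open>a \<in> A_C\<close> by (auto simp: K_C_iff A_C_mat2)
    then have "a \<in> {mat 1, - mat 1}" by (auto simp: mat_1_mat2 power2_eq_1_iff)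
    then show False using g by (simp add: A_C'_def)
  qed
  ultimately show "g \<in> K_C \<otimes>\<^sub>S A_C \<otimes>\<^sub>S K_C - K_C" by simp
next
  fix g assume h: "g \<in> K_C \<otimes>\<^sub>S A_C \<otimes>\<^sub>S K_C - K_C"
  then obtain k a l where g: "k \<in> K_C" "l \<in> K_C" "a \<in> A_C" "g = k ** a ** l"
    by (auto simp: set_mult3_iff)
  have "mat 1 \<in> K_C" "- mat 1 \<in> K_C" by (auto simp: K_C_iff mat_1_mat2)
  then have "a \<notin> {mat 1, - mat 1}" using h g by (auto intro!: K_C_mult)
  then show "g \<in> K_C \<otimes>\<^sub>S A_C' \<otimes>\<^sub>S K_C" using g by (auto simp: set_mult3_iff A_C'_def)
qed

lemma SL2C_cases:
  assumes "det g = 1"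
  obtains "g \<in> K_C \<otimes>\<^sub>S A_C \<otimes>\<^sub>S K_C"
  | e u where "e \<in> {1,-1}" "u \<noteq> 0" "gram g = p_sgn e (2*u)"
  | e u where "e \<in> {1,-1}" "u \<noteq> 0" "gram g = - p_sgn e (2*u)"
proof -
  obtain x y z w where g: "g = mat2 x y z w" by (rule mat2_cases)
  obtain a b d where G: "gram g = mat2 a b b d" by (simp add: g gram_mat2)
  have "det (gram g) = 1" using assms by (simp add: gram_def det_mul)
  then have det: "a * d - b * b = 1" by (simp add: G)
  have KAK: "g \<in> K_C \<otimes>\<^sub>S A_C \<otimes>\<^sub>S K_C"
    if "k \<in> K_C" "z \<noteq> 0" "gram g = gram (k ** mat2 z 0 0 (inverse z))" for k z
  proof -
    have "det (k ** mat2 z 0 0 (inverse z)) = 1" using that by (simp add: det_mul K_C_det)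
    from gram_eq_imp_coset[OF this assms that(3)] show ?thesis
      using that by (auto simp: set_mult3_iff A_C_mat2)
  qed
  show thesis
  proof (cases "(a + d)\<^sup>2 = 4")
    case False
    then show thesis using diagonalize_symmetric[OF det] KAK that(1) G by auto
  next
    case True
    from symmetric_trace_cases[OF det True] obtain e u where
      e: "e \<in> {1,-1}" and u: "gram g = p_sgn e (2*u) \<or> gram g = - p_sgn e (2*u)"
      by (auto simp: G)
    show thesis
    proof (cases "u = 0")
      case True
      \<comment> \<open>The matrices 1 and -1 are the Gram matrices of 1 and of diag(i, -i), so a
        zero parameter falls into the first case.\<close>
      then have "gram g = gram (mat 1 ** mat2 1 0 0 (inverse 1)) \<or>
          gram g = gram (mat 1 ** mat2 \<i> 0 0 (inverse \<i>))"
        using u by (auto simp: p_sgn_def gram_mat2)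
      then show thesis
        using KAK[OF one_in_K_C, of 1] KAK[OF one_in_K_C, of \<i>] that(1) by auto
    qed (use e u that in blast)
  qed
qed

section \<open>Bi-invariance\<close>

text \<open>With \<open>p_sgn e u\<close> written as 1 + u N, conjugation by the rotation multiplies
  N by the square of c + i e s.\<close>

lemma rotation_p_sgn:
  assumes "c\<^sup>2 + s\<^sup>2 = 1" "e * e = 1"
  shows "mat2 c s (-s) c ** p_sgn e u = p_sgn e ((c + \<i> * e * s)\<^sup>2 * u) ** mat2 c s (-s) c"
proof -
  define v where "v = (c + \<i> * e * s)\<^sup>2 * u"
  have i: "\<i> * \<i> = -1" by simp
  \<comment> \<open>The inverse of c + i e s is c - i e s, which turns the square in
    \<open>v\<close> into a relation linear in \<open>c\<close> and \<open>s\<close>.\<close>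
  have "(c + \<i> * e * s) * (c - \<i> * e * s) = 1" using assms i by algebra
  then have "v * (c - \<i> * e * s) = (c + \<i> * e * s) * u" unfolding v_def by algebra
  then have "v * c - \<i> * e * s * v = c * u + \<i> * e * s * u" by (simp add: algebra_simps)
  then show ?thesis
    unfolding v_def[symmetric] p_sgn_def mat2_mult mat2_eq_iff using assms(2) i
    by (intro conjI; algebra)
qed

lemma K_C_p_sgn_commute:
  assumes "k \<in> K_C" "e * e = 1" "u \<noteq> 0"
  shows "\<exists>v. v \<noteq> 0 \<and> k ** p_sgn e u = p_sgn e v ** k"
proof -
  obtain c s where k: "k = mat2 c s (-s) c" "c\<^sup>2 + s\<^sup>2 = 1" using assms K_C_iff by blast
  have "\<i> * \<i> = -1" by simp
  then have "(c + \<i> * e * s) * (c - \<i> * e * s) = 1" using k(2) assms(2) by algebra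
  then have "(c + \<i> * e * s)\<^sup>2 * u \<noteq> 0" using assms by auto
  then show ?thesis using rotation_p_sgn[OF k(2) assms(2)] k(1) by blast
qed

text \<open>Right factors are absorbed by the trailing \<open>K_C\<close>, and the reverse inclusion
  comes from 1 in \<open>K_C\<close>; what remains is to move a left factor across
  \<open>T\<close>.\<close>

lemma K_biinvariantI:
  assumes "\<And>k g. k \<in> K_C \<Longrightarrow> g \<in> T \<Longrightarrow> k ** g \<in> T \<otimes>\<^sub>S K_C"
  shows "K_biinvariant (T \<otimes>\<^sub>S K_C)"
  unfolding K_biinvariant_def
proof (intro set_eqI iffI)
  fix x assume "x \<in> K_C \<otimes>\<^sub>S (T \<otimes>\<^sub>S K_C) \<otimes>\<^sub>S K_C"
  then obtain k y m where x: "k \<in> K_C" "y \<in> T \<otimes>\<^sub>S K_C" "m \<in> K_C" "x = k ** y ** m"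
    unfolding set_mult3_iff by blast
  obtain g l where y: "g \<in> T" "l \<in> K_C" "y = g ** l" using x(2) unfolding set_mult_iff by blast
  obtain h n where h: "h \<in> T" "n \<in> K_C" "k ** g = h ** n"
    using assms[OF x(1) y(1)] unfolding set_mult_iff by blast
  have "x = k ** g ** l ** m" by (simp add: x y matrix_mul_assoc)
  also have "\<dots> = h ** (n ** l ** m)" by (simp add: h matrix_mul_assoc)
  finally show "x \<in> T \<otimes>\<^sub>S K_C"
    unfolding set_mult_iff using K_C_mult[OF K_C_mult[OF h(2) y(2)] x(3)] h(1) by blast
next
  fix x assume "x \<in> T \<otimes>\<^sub>S K_C"
  then show "x \<in> K_C \<otimes>\<^sub>S (T \<otimes>\<^sub>S K_C) \<otimes>\<^sub>S K_C"
    unfolding set_mult3_iff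
    by (intro bexI[of _ "mat 1"] bexI[of _ x]) (simp_all add: one_in_K_C)
qed

lemma subset_set_mult_K_C: "T \<subseteq> T \<otimes>\<^sub>S K_C"
proof
  fix x assume "x \<in> T"
  then show "x \<in> T \<otimes>\<^sub>S K_C"
    unfolding set_mult_iff by (intro bexI[of _ x] bexI[of _ "mat 1"]) (simp_all add: one_in_K_C)
qed

lemma K_C_set_mult_self: "K_C \<otimes>\<^sub>S K_C = K_C"
  using subset_set_mult_K_C[of K_C] by (auto simp: set_mult_iff intro: K_C_mult)

lemma K_biinvariant_K_C: "K_biinvariant K_C"
  by (simp add: K_biinvariant_def K_C_set_mult_self)

lemma K_biinvariant_KAK: "K_biinvariant (K_C \<otimes>\<^sub>S T \<otimes>\<^sub>S K_C)"
proof (rule K_biinvariantI)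
  fix k g assume k: "k \<in> K_C" and "g \<in> K_C \<otimes>\<^sub>S T"
  then obtain l a where g: "g = l ** a" "l \<in> K_C" "a \<in> T" unfolding set_mult_iff by blast
  have "k ** g = (k ** l) ** a" by (simp add: g matrix_mul_assoc)
  then have "k ** g \<in> K_C \<otimes>\<^sub>S T"
    unfolding set_mult_iff using K_C_mult[OF k g(2)] g(3) by blast
  then show "k ** g \<in> K_C \<otimes>\<^sub>S T \<otimes>\<^sub>S K_C" using subset_set_mult_K_C by blast
qed

lemma K_biinvariant_PK:
  assumes "e * e = 1"
  shows "K_biinvariant (p_sgn e ` (- {0}) \<otimes>\<^sub>S K_C)"
  using K_C_p_sgn_commute[OF _ assms]
  by (intro K_biinvariantI) (fastforce simp: set_mult_iff)

lemma K_biinvariant_Py0K: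
  assumes "e * e = 1"
  shows "K_biinvariant (p_sgn e ` (- {0}) \<otimes>\<^sub>S {y0} \<otimes>\<^sub>S K_C)"
proof (rule K_biinvariantI)
  fix k g assume k: "k \<in> K_C" and "g \<in> p_sgn e ` (- {0}) \<otimes>\<^sub>S {y0}"
  then obtain u where u: "u \<noteq> 0" "g = p_sgn e u ** y0" by (auto simp: set_mult_iff)
  obtain v where v: "v \<noteq> 0" "k ** p_sgn e u = p_sgn e v ** k"
    using K_C_p_sgn_commute[OF k assms u(1)] by blast
  \<comment> \<open>Conjugation by \<open>y0\<close> negates the off-diagonal entries and so inverts
    a rotation; the inverse is absorbed on the right.\<close>
  have ky: "k ** y0 = y0 ** transpose k"
    using k by (auto simp: K_C_iff y0_mat2 mat2_mult)
  have "k ** g = p_sgn e v ** (k ** y0)" by (simp add: u v matrix_mul_assoc)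
  also have "\<dots> = p_sgn e v ** y0 ** transpose k" by (simp add: ky matrix_mul_assoc)
  finally show "k ** g \<in> p_sgn e ` (- {0}) \<otimes>\<^sub>S {y0} \<otimes>\<^sub>S K_C"
    unfolding set_mult3_iff using K_C_transpose[OF k] v(1) by blast
qed

section \<open>The tube\<close>

lemma mat_exp_diag2: "mat_exp (diag2 x y) = diag2 (exp x) (exp y)"
proof -
  have pow: "mat_power (mat2 x 0 0 y) n = mat2 (x ^ n) 0 0 (y ^ n)" for n
    by (induction n) (simp_all add: mat_1_mat2 mat2_mult)
  have "(\<lambda>n. mat_power (diag2 x y) n /\<^sub>R fact n) sums diag2 (exp x) (exp y)"
    unfolding sums_def
  proof (intro vec_tendstoI)
    fix i j :: 2
    have "(\<lambda>n. z ^ n /\<^sub>R fact n) sums exp z" for z :: complex by (rule exp_converges)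
    then show "(\<lambda>n. (\<Sum>m<n. mat_power (diag2 x y) m /\<^sub>R fact m) $ i $ j)
        \<longlonglongrightarrow> diag2 (exp x) (exp y) $ i $ j"
      using exhaust_2[of i] exhaust_2[of j] by (auto simp: pow sum_component diag2_def sums_def)
  qed
  then show ?thesis by (simp add: mat_exp_def sums_iff)
qed

lemma exp_i_Omega_eq: "exp_i_Omega = {mat2 (cis t) 0 0 (cis (-t)) | t. \<bar>t\<bar> < pi/4}"
proof -
  have "mat_exp (map_matrix ((*) \<i>) (diag2 (complex_of_real t) (- complex_of_real t))) =
      mat2 (cis t) 0 0 (cis (-t))" for t
    using mat_exp_diag2[of "\<i> * t" "- \<i> * t"] by (simp add: diag2_def cis_conv_exp)
  moreover have "exp_i_Omega = (\<lambda>t. mat_exp (map_matrix ((*) \<i>)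
      (diag2 (complex_of_real t) (- complex_of_real t)))) ` {t. \<bar>t\<bar> < pi/4}"
    unfolding exp_i_Omega_def Omega_def by blast
  ultimately show ?thesis by auto
qed

lemma SL2R_eq: "SL2R = {mat2 (complex_of_real a) b c d | a b c d :: real. a * d - b * c = 1}"
proof (intro set_eqI iffI)
  fix h assume "h \<in> SL2R"
  then obtain g :: "real^2^2" where "det g = 1" "h = map_matrix complex_of_real g"
    by (auto simp: SL2R_def)
  moreover obtain a b c d where "g = mat2 a b c d" by (rule mat2_cases)
  ultimately show "h \<in> {mat2 (complex_of_real a) b c d | a b c d :: real. a * d - b * c = 1}"
    by auto
next
  fix h assume "h \<in> {mat2 (complex_of_real a) b c d | a b c d :: real. a * d - b * c = 1}"
  then obtain a b c d :: real where "a * d - b * c = 1" "h = mat2 (complex_of_real a) b c d"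
    by blast
  then show "h \<in> SL2R"
    unfolding SL2R_def by (intro image_eqI[of _ _ "mat2 a b c d"]) simp_all
qed

text \<open>The Gram matrix of h diag(cis (t/2), cis (-t/2)) for the real matrix h with rows (a, b)
  and (c, d).\<close>
definition gram_tube :: "real \<Rightarrow> real \<Rightarrow> real \<Rightarrow> real \<Rightarrow> real \<Rightarrow> cmat" where
  "gram_tube a b c d t = mat2 (a\<^sup>2 * cis t + b\<^sup>2 * cis (-t)) (a*c*cis t + b*d*cis (-t))
     (a*c*cis t + b*d*cis (-t)) (c\<^sup>2 * cis t + d\<^sup>2 * cis (-t))"

lemma gram_tube_eq:
  "gram (mat2 (complex_of_real a) b c d ** mat2 (cis t) 0 0 (cis (-t))) = gram_tube a b c d (2*t)"
proof -
  have "cis (2*t) = cis t * cis t" "cis (-(2*t)) = cis (-t) * cis (-t)"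
    by (simp_all add: cis_mult)
  then show ?thesis
    by (simp add: gram_tube_def mat2_mult gram_mat2 power2_eq_square algebra_simps)
qed

text \<open>The Gram matrix squares the diagonal factor and doubles its angle, which turns the bound
  pi/4 into pi/2.\<close>

lemma Xi_tilde_iff:
  "g \<in> Xi_tilde \<longleftrightarrow> det g = 1 \<and>
     (\<exists>a b c d t. a * d - b * c = 1 \<and> \<bar>t\<bar> < pi/2 \<and> gram g = gram_tube a b c d t)"
proof -
  let ?m = "\<lambda>(a::real) (b::real) (c::real) (d::real) t.
    mat2 (complex_of_real a) b c d ** mat2 (cis t) 0 0 (cis (-t))"
  have S: "SL2R \<otimes>\<^sub>S exp_i_Omega = {?m a b c d t | a b c d t. a * d - b * c = 1 \<and> \<bar>t\<bar> < pi/4}"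
    unfolding set_mult_def SL2R_eq exp_i_Omega_eq by blast
  have "det (?m a b c d t) = 1" if "a * d - b * c = 1" for a b c d t :: real
    using that by (simp add: det_mul cis_mult flip: of_real_mult of_real_diff)
  then have "g \<in> Xi_tilde \<longleftrightarrow> det g = 1 \<and> (\<exists>s\<in>SL2R \<otimes>\<^sub>S exp_i_Omega. gram g = gram s)"
    unfolding Xi_tilde_def by (intro coset_iff_gram) (auto simp: S)
  also have "(\<exists>s\<in>SL2R \<otimes>\<^sub>S exp_i_Omega. gram g = gram s) \<longleftrightarrow>
    (\<exists>a b c d t. a * d - b * c = 1 \<and> \<bar>t\<bar> < pi/4 \<and> gram g = gram (?m a b c d t))"
    unfolding S by blast
  also have "\<dots> \<longleftrightarrow>
    (\<exists>a b c d t. a * d - b * c = 1 \<and> \<bar>t\<bar> < pi/4 \<and> gram g = gram_tube a b c d (2 * t))"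
    unfolding gram_tube_eq ..
  also have "\<dots> \<longleftrightarrow>
    (\<exists>a b c d t. a * d - b * c = 1 \<and> \<bar>t\<bar> < pi/2 \<and> gram g = gram_tube a b c d t)"
  proof -
    have "(\<exists>t. \<bar>t\<bar> < pi/4 \<and> P (2 * t)) \<longleftrightarrow> (\<exists>t. \<bar>t\<bar> < pi/2 \<and> P t)" for P :: "real \<Rightarrow> bool"
    proof
      assume "\<exists>t. \<bar>t\<bar> < pi/4 \<and> P (2 * t)"
      then obtain t where "\<bar>t\<bar> < pi/4" "P (2 * t)" by blast
      then show "\<exists>t. \<bar>t\<bar> < pi/2 \<and> P t" by (intro exI[of _ "2 * t"]) auto
    next
      assume "\<exists>t. \<bar>t\<bar> < pi/2 \<and> P t"
      then obtain t where "\<bar>t\<bar> < pi/2" "P t" by blast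
      then show "\<exists>t. \<bar>t\<bar> < pi/4 \<and> P (2 * t)" by (intro exI[of _ "t / 2"]) auto
    qed
    from this[of "\<lambda>t. gram g = gram_tube _ _ _ _ t"] show ?thesis
      by (simp only: ex_simps)
  qed
  finally show ?thesis .
qed

text \<open>The real part is \<open>cos t\<close> times the Gram matrix of the real invertible
  matrix with rows (a, b) and (c, d), hence positive definite; trace and determinant record
  this.\<close>

lemma gram_tube_Re:
  assumes "a * d - b * c = 1" "\<bar>t\<bar> < pi/2" "gram_tube a b c d t = mat2 x y y z"
  shows "Re x + Re z > 0" "Re x * Re z - (Re y)\<^sup>2 > 0"
proof -
  have ct: "cos t > 0" using assms(2) by (intro cos_gt_zero_pi) auto
  have xyz: "Re x = (a\<^sup>2 + b\<^sup>2) * cos t" "Re y = (a*c + b*d) * cos t" "Re z = (c\<^sup>2 + d\<^sup>2) * cos t"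
    using assms(3) by (auto simp: gram_tube_def algebra_simps simp flip: of_real_power of_real_mult)
  have "Re x + Re z = (a\<^sup>2 + b\<^sup>2 + c\<^sup>2 + d\<^sup>2) * cos t" by (simp add: xyz algebra_simps)
  moreover have "a\<^sup>2 + b\<^sup>2 + c\<^sup>2 + d\<^sup>2 > 0"
  proof -
    have "a \<noteq> 0 \<or> b \<noteq> 0" using assms(1) by auto
    then have "a\<^sup>2 + b\<^sup>2 > 0" by (simp add: sum_power2_gt_zero_iff)
    then show ?thesis by (simp add: add_pos_nonneg)
  qed
  ultimately show "Re x + Re z > 0" using ct by simp
  have "Re x * Re z - (Re y)\<^sup>2 = (a * d - b * c)\<^sup>2 * (cos t)\<^sup>2"
    unfolding xyz by algebra
  then show "Re x * Re z - (Re y)\<^sup>2 > 0" using ct assms(1) by simp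
qed

section \<open>Unipotent matrices as Gram matrices of the tube\<close>

text \<open>\<open>gram_tube\<close> is h D h^T with h real and D diagonal, so a real congruence
  changes only h.\<close>

lemma gram_tube_conj:
  fixes p q r s :: real
  shows "mat2 (complex_of_real p) q r s ** gram_tube a b c d t ** transpose (mat2 (complex_of_real p) q r s) =
    gram_tube (p*a+q*c) (p*b+q*d) (r*a+s*c) (r*b+s*d) t"
  by (simp add: gram_tube_def mat2_mult) (simp add: algebra_simps power2_eq_square)

text \<open>The real part is diagonal with positive entries. Rescaling it to 1 turns the imaginary
  part into tan t times the coordinate swap, where \<open>sin t = r\<close>; the eigenvectors (1, 1)
  and (-1, 1) of the swap give the columns of the congruence.\<close>

lemma p_sgn_real_in_tube:
  fixes r \<epsilon> :: real
  assumes "\<epsilon> \<in> {1,-1}" "\<bar>r\<bar> < 1"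
  shows "\<exists>a b c d t. a * d - b * c = 1 \<and> \<bar>t\<bar> < pi/2 \<and>
    p_sgn \<epsilon> r = gram_tube a b c d t"
proof -
  define t where "t = arcsin r"
  have "- 1 < r" "r < 1" using assms(2) by auto
  then have t: "\<bar>t\<bar> < pi/2" and st: "sin t = r"
    using arcsin_lt_bounded[of r] by (auto simp: t_def abs_if)
  have ct: "cos t > 0" using t by (intro cos_gt_zero_pi) auto
  have pos: "1 + \<epsilon> * r > 0" "1 - \<epsilon> * r > 0" using assms by auto
  \<comment> \<open>The rows of the real matrix are scaled by \<open>\<alpha>\<close> and
    \<open>\<beta>\<close>, whose product is \<open>cos t\<close>; \<open>\<kappa>\<close> brings
    the determinant to 1.\<close>
  define \<alpha> \<beta> \<kappa> where "\<alpha> = sqrt (1 + \<epsilon> * r)" "\<beta> = sqrt (1 - \<epsilon> * r)" "\<kappa> = sqrt (1 / (2 * cos t))"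
  have sq: "\<alpha>\<^sup>2 = 1 + \<epsilon> * r" "\<beta>\<^sup>2 = 1 - \<epsilon> * r" "\<kappa>\<^sup>2 = 1 / (2 * cos t)"
    using pos ct by (simp_all add: \<alpha>_\<beta>_\<kappa>_def)
  have "(\<alpha> * \<beta>)\<^sup>2 = 1 - r\<^sup>2"
    using assms(1) by (auto simp: power_mult_distrib sq) (auto simp: algebra_simps power2_eq_square)
  also have "\<dots> = (cos t)\<^sup>2" by (simp add: cos_squared_eq st)
  finally have \<alpha>\<beta>: "\<alpha> * \<beta> = cos t"
    using ct pos by (subst (asm) power2_eq_iff_nonneg) (auto simp: \<alpha>_\<beta>_\<kappa>_def)
  have cis: "cis t + cis (-t) = complex_of_real (2 * cos t)"
    "cis t - cis (-t) = \<i> * complex_of_real (2 * r)"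
    by (simp_all add: complex_eq_iff st)
  have "gram_tube (\<kappa>*\<alpha>) (-\<kappa>*\<alpha>) (\<kappa>*\<beta>) (\<kappa>*\<beta>) t =
    mat2 (complex_of_real (\<kappa>\<^sup>2 * \<alpha>\<^sup>2) * (cis t + cis (-t))) (complex_of_real (\<kappa>\<^sup>2 * (\<alpha>*\<beta>)) * (cis t - cis (-t)))
      (complex_of_real (\<kappa>\<^sup>2 * (\<alpha>*\<beta>)) * (cis t - cis (-t))) (complex_of_real (\<kappa>\<^sup>2 * \<beta>\<^sup>2) * (cis t + cis (-t)))"
    by (simp add: gram_tube_def) (simp add: algebra_simps power2_eq_square)
  also have "\<dots> = p_sgn \<epsilon> r"
    using ct unfolding cis \<alpha>\<beta> sq by (simp add: p_sgn_def)
  finally have "p_sgn \<epsilon> r = gram_tube (\<kappa>*\<alpha>) (-\<kappa>*\<alpha>) (\<kappa>*\<beta>) (\<kappa>*\<beta>) t" by simp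
  moreover have "\<kappa>*\<alpha> * (\<kappa>*\<beta>) - -\<kappa>*\<alpha> * (\<kappa>*\<beta>) = 2 * \<kappa>\<^sup>2 * (\<alpha>*\<beta>)"
    by (simp add: power2_eq_square)
  then have "\<kappa>*\<alpha> * (\<kappa>*\<beta>) - -\<kappa>*\<alpha> * (\<kappa>*\<beta>) = 1" using ct unfolding \<alpha>\<beta> sq by simp
  ultimately show ?thesis using t by blast
qed

text \<open>A real rotation changes the phase of the parameter of \<^const>\<open>p_sgn\<close> arbitrarily, which
  reduces the claim to a real parameter.\<close>
lemma p_sgn_in_tube:
  assumes "e \<in> {1,-1}" "norm u < 1"
  shows "\<exists>a b c d t. a * d - b * c = 1 \<and> \<bar>t\<bar> < pi/2 \<and> p_sgn e u = gram_tube a b c d t"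
proof -
  obtain \<epsilon> :: real where \<epsilon>: "e = \<epsilon>" "\<epsilon> \<in> {1,-1}"
    using assms(1) by (metis insert_iff of_real_1 of_real_minus singletonD)
  then have ee: "e * e = 1" by auto
  have e2: "\<epsilon> * \<epsilon> = 1" using \<epsilon>(2) by auto
  define r where "r = norm u"
  \<comment> \<open>A rotation acts on the parameter through a square, hence half the argument. The
    factor \<open>\<epsilon>\<close> in \<open>q\<close> cancels the \<open>e\<close> in
    \<open>rotation_p_sgn\<close>.\<close>
  define p where "p = cos (Arg u / 2)"
  define q where "q = \<epsilon> * sin (Arg u / 2)"
  have pq: "p\<^sup>2 + q\<^sup>2 = 1" using e2 by (simp add: p_def q_def power_mult_distrib power2_eq_square[of \<epsilon>])
  then have pq': "(complex_of_real p)\<^sup>2 + (complex_of_real q)\<^sup>2 = 1"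
    by (metis of_real_1 of_real_add of_real_power)
  have "complex_of_real p + \<i> * e * q = complex_of_real p + \<i> * ((\<epsilon> * \<epsilon>) * sin (Arg u / 2))"
    by (simp add: q_def \<epsilon>)
  also have "\<dots> = cis (Arg u / 2)" unfolding e2 by (simp add: p_def complex_eq_iff)
  finally have "(complex_of_real p + \<i> * e * q)\<^sup>2 * r = u"
    using rcis_cmod_Arg[of u] by (simp add: r_def rcis_def power2_eq_square cis_mult mult.commute)
  moreover define k where "k = mat2 (complex_of_real p) q (-q) p"
  ultimately have "k ** p_sgn e r = p_sgn e u ** k"
    using rotation_p_sgn[OF pq' ee, of r] by simp
  moreover have "k ** transpose k = mat 1"
    using pq' by (intro K_C_mult_transpose) (auto simp: k_def K_C_iff)
  ultimately have u: "p_sgn e u = k ** p_sgn e r ** transpose k"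
    by (metis matrix_mul_assoc matrix_mul_rid)
  obtain a b c d t where *: "a * d - b * c = 1" "\<bar>t\<bar> < pi/2" "p_sgn e r = gram_tube a b c d t"
    using p_sgn_real_in_tube[OF \<epsilon>(2), of r] assms(2) \<epsilon>(1) by (auto simp: r_def)
  have "p_sgn e u = gram_tube (p*a+q*c) (p*b+q*d) ((-q)*a+p*c) ((-q)*b+p*d) t"
    unfolding u *(3) k_def using gram_tube_conj[of p q "-q" p] by simp
  moreover have "(p*a+q*c) * ((-q)*b+p*d) - (p*b+q*d) * ((-q)*a+p*c) = 1"
    using pq *(1) by algebra
  ultimately show ?thesis using *(2) by blast
qed

text \<open>Lying in the tube amounts to norm below 1 for the parameter of the Gram matrix, which is
  twice that of the coset; hence the radius 1/2.\<close>

lemma P_half_cosets: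
  assumes "e \<in> {1,-1}"
  shows "p_sgn e ` {v. 0 < norm v \<and> norm v < 1/2} \<otimes>\<^sub>S K_C =
    Xi_tilde \<inter> (p_sgn e ` (- {0}) \<otimes>\<^sub>S K_C)"
proof -
  have e: "e * e = 1" using assms by auto
  have small: "norm u < 1/2"
    if "a * d - b * c = 1" "\<bar>t\<bar> < pi/2" "p_sgn e (2*u) = gram_tube a b c d t" for a b c d t u
  proof -
    have "gram_tube a b c d t = mat2 (1 + e * (2*u)) (\<i> * (2*u)) (\<i> * (2*u)) (1 - e * (2*u))"
      using that(3) by (simp add: p_sgn_def)
    \<comment> \<open>The determinant of the real part is 1 - 4 |u|^2 for either sign
      \<open>e\<close>.\<close>
    from gram_tube_Re(2)[OF that(1,2) this]
    have "(norm u)\<^sup>2 < (1/2)\<^sup>2"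
      using assms by (auto simp: cmod_power2) (auto simp: algebra_simps power2_eq_square)
    then show ?thesis by (rule power_less_imp_less_base) simp
  qed
  show ?thesis
  proof (intro set_eqI iffI)
    fix g assume "g \<in> p_sgn e ` {v. 0 < norm v \<and> norm v < 1/2} \<otimes>\<^sub>S K_C"
    then obtain u where u: "det g = 1" "u \<noteq> 0" "norm u < 1/2" "gram g = p_sgn e (2*u)"
      unfolding P_coset_iff[OF e] by auto
    have "norm (2*u) < 1" using u(3) by (simp add: norm_mult)
    then have "g \<in> Xi_tilde" using p_sgn_in_tube[OF assms] u unfolding Xi_tilde_iff by simp
    then show "g \<in> Xi_tilde \<inter> (p_sgn e ` (- {0}) \<otimes>\<^sub>S K_C)"
      using u unfolding Int_iff P_coset_iff[OF e] by blast
  next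
    fix g assume g: "g \<in> Xi_tilde \<inter> (p_sgn e ` (- {0}) \<otimes>\<^sub>S K_C)"
    then obtain u where u: "det g = 1" "u \<noteq> 0" "gram g = p_sgn e (2*u)"
      unfolding Int_iff P_coset_iff[OF e] by blast
    have "norm u < 1/2" using small g u(3) unfolding Int_iff Xi_tilde_iff by metis
    then show "g \<in> p_sgn e ` {v. 0 < norm v \<and> norm v < 1/2} \<otimes>\<^sub>S K_C"
      using u unfolding P_coset_iff[OF e] by auto
  qed
qed

section \<open>Separating the families and assembling the decompositions\<close>

lemma SL2C_decomposition:
  assumes "det g = 1"
  shows "g \<in> K_C \<otimes>\<^sub>S A_C \<otimes>\<^sub>S K_C \<or> (\<exists>e\<in>{1,-1}.
    g \<in> p_sgn e ` (- {0}) \<otimes>\<^sub>S K_C \<or> g \<in> p_sgn e ` (- {0}) \<otimes>\<^sub>S {y0} \<otimes>\<^sub>S K_C)"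
  using assms
proof (cases rule: SL2C_cases)
  case (2 e u)
  then have "e * e = 1" by auto
  then have "g \<in> p_sgn e ` (- {0}) \<otimes>\<^sub>S K_C" using 2 assms by (auto simp: P_coset_iff)
  then show ?thesis using 2(1) by blast
next
  case (3 e u)
  then have "e * e = 1" by auto
  then have "g \<in> p_sgn e ` (- {0}) \<otimes>\<^sub>S {y0} \<otimes>\<^sub>S K_C" using 3 assms by (auto simp: P_y0_coset_iff)
  then show ?thesis using 3(1) by blast
qed simp

lemma p_sgn_eq_iff: "p_sgn e u = p_sgn f v \<longleftrightarrow> u = v \<and> (u = 0 \<or> e = f)"
  by (auto simp: p_sgn_def)

lemma trace_p_sgn: "trace (p_sgn e u) = 2" "trace (- p_sgn e u) = - 2"
  by (simp_all add: p_sgn_def trace_mat2)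

text \<open>The trace is 2 or -2, so \<open>KAK_gram\<close> makes the Gram matrix scalar; this
  separates the diagonalizable family from the unipotent ones.\<close>

lemma KAK_gram_p_sgn:
  assumes "g \<in> K_C \<otimes>\<^sub>S A_C \<otimes>\<^sub>S K_C"
  shows "gram g = p_sgn e u \<Longrightarrow> u = 0" "gram g = - p_sgn e u \<Longrightarrow> u = 0"
  using KAK_gram(2,3)[OF assms] by (auto simp: trace_p_sgn p_sgn_eq_1_iff)

text \<open>The real part would have trace -2, against its positivity; this keeps both
  \<open>y0\<close> families out of the tube.\<close>

lemma Xi_tilde_gram_neq:
  assumes "g \<in> Xi_tilde"
  shows "gram g \<noteq> - p_sgn e u"
proof
  assume "gram g = - p_sgn e u"
  then have G: "gram g = mat2 (- 1 - e * u) (- \<i> * u) (- \<i> * u) (- 1 + e * u)"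
    by (simp add: p_sgn_def)
  obtain a b c d t where "a * d - b * c = 1" "\<bar>t\<bar> < pi/2" "gram g = gram_tube a b c d t"
    using assms by (auto simp: Xi_tilde_iff)
  from gram_tube_Re(1)[OF this(1,2) this(3)[unfolded G, symmetric]] show False by simp
qed

text \<open>Splitting index 0 from the successors lets disjointness of a concrete list unfold into
  finitely many pairwise intersections.\<close>

lemma disjoint_family_on_nth_Cons:
  "disjoint_family_on ((!) (X # Xs)) {..<length (X # Xs)} \<longleftrightarrow>
    (\<forall>Y\<in>set Xs. X \<inter> Y = {}) \<and> disjoint_family_on ((!) Xs) {..<length Xs}"
proof -
  have "disjoint_family_on ((!) (X # Xs)) {..<length (X # Xs)} \<longleftrightarrow>
     (\<forall>i<Suc (length Xs). \<forall>j<Suc (length Xs). i \<noteq> j \<longrightarrow> (X # Xs) ! i \<inter> (X # Xs) ! j = {})"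
    unfolding disjoint_family_on_def Ball_def lessThan_iff length_Cons ..
  also have "\<dots> \<longleftrightarrow> (\<forall>j<length Xs. X \<inter> Xs ! j = {}) \<and>
     (\<forall>i<length Xs. Xs ! i \<inter> X = {} \<and> (\<forall>j<length Xs. i \<noteq> j \<longrightarrow> Xs ! i \<inter> Xs ! j = {}))"
    unfolding All_less_Suc2 by simp
  also have "\<dots> \<longleftrightarrow> (\<forall>Y\<in>set Xs. X \<inter> Y = {}) \<and> disjoint_family_on ((!) Xs) {..<length Xs}"
    unfolding disjoint_family_on_def all_set_conv_all_nth Int_commute[of _ X]
    unfolding Ball_def lessThan_iff
    by (simp add: imp_conjR all_conj_distrib)
  finally show ?thesis .
qed

theorem theorem3p3:
  shows
    "(let Xs = [K_C \<otimes>\<^sub>S A_C' \<otimes>\<^sub>S K_C,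
                P_minus' \<otimes>\<^sub>S K_C,
                P_plus' \<otimes>\<^sub>S K_C,
                P_minus' \<otimes>\<^sub>S {y0} \<otimes>\<^sub>S K_C,
                P_plus' \<otimes>\<^sub>S {y0} \<otimes>\<^sub>S K_C,
                K_C]
      in is_disjoint_union SL2C Xs \<and> (\<forall>X\<in>set Xs. K_biinvariant X))
     \<and> is_disjoint_union (Xi_tilde - K_C \<otimes>\<^sub>S A_C \<otimes>\<^sub>S K_C)
         [P_minus_half \<otimes>\<^sub>S K_C, P_plus_half \<otimes>\<^sub>S K_C]"
proof -
  define KAK where "KAK = K_C \<otimes>\<^sub>S A_C \<otimes>\<^sub>S K_C"
  define Q where "Q e = p_sgn e ` (- {0}) \<otimes>\<^sub>S K_C" for e
  define R where "R e = p_sgn e ` (- {0}) \<otimes>\<^sub>S {y0} \<otimes>\<^sub>S K_C" for e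
  have Q: "\<exists>u. u \<noteq> 0 \<and> gram g = p_sgn e u" "det g = 1" if g: "g \<in> Q e" and "e \<in> {1,-1}" for g e
  proof -
    have e: "e * e = 1" using that(2) by auto
    obtain u where "det g = 1" "u \<noteq> 0" "gram g = p_sgn e (2 * u)"
      using g[unfolded Q_def P_coset_iff[OF e]] by auto
    then show "\<exists>u. u \<noteq> 0 \<and> gram g = p_sgn e u" "det g = 1" by (auto intro: exI[of _ "2 * u"])
  qed
  have R: "\<exists>u. u \<noteq> 0 \<and> gram g = - p_sgn e u" "det g = 1" if g: "g \<in> R e" and "e \<in> {1,-1}" for g e
  proof -
    have e: "e * e = 1" using that(2) by auto
    obtain u where "det g = 1" "u \<noteq> 0" "gram g = - p_sgn e (2 * u)"
      using g[unfolded R_def P_y0_coset_iff[OF e]] by auto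
    then show "\<exists>u. u \<noteq> 0 \<and> gram g = - p_sgn e u" "det g = 1" by (auto intro: exI[of _ "2 * u"])
  qed
  have K: "K_C \<subseteq> KAK"
  proof
    fix k assume "k \<in> K_C"
    moreover have "mat 1 \<in> A_C" by (auto simp: A_C_mat2 mat_1_mat2 intro: exI[of _ 1])
    ultimately show "k \<in> KAK"
      unfolding KAK_def set_mult3_iff
      by (intro bexI[of _ k] bexI[of _ "mat 1"]) (simp_all add: one_in_K_C)
  qed
  have disj: "KAK \<inter> Q e = {}" "KAK \<inter> R e = {}" "Q e \<inter> R f = {}"
    if e: "e \<in> {1,-1}" and f: "f \<in> {1,-1}" for e f
  proof -
    show "KAK \<inter> Q e = {}" using Q(1)[OF _ e] KAK_gram_p_sgn(1)[folded KAK_def] by blast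
    show "KAK \<inter> R e = {}" using R(1)[OF _ e] KAK_gram_p_sgn(2)[folded KAK_def] by blast
    \<comment> \<open>The trace of the Gram matrix separates the families with and without
      \<open>y0\<close>, whatever the signs \<open>e\<close> and \<open>f\<close>.\<close>
    have "trace (gram g) = 2" if "g \<in> Q e" for g using Q(1)[OF that e] trace_p_sgn(1) by auto
    moreover have "trace (gram g) = - 2" if "g \<in> R f" for g
      using R(1)[OF that f] trace_p_sgn(2) by auto
    ultimately show "Q e \<inter> R f = {}" by fastforce
  qed
  \<comment> \<open>The trace does not see \<open>e\<close>; here a nonzero parameter separates the
    two signs through \<open>p_sgn_eq_iff\<close>.\<close>
  have disj': "Q (-1) \<inter> Q 1 = {}" "R (-1) \<inter> R 1 = {}"
  proof -
    have False if g: "g \<in> Q (-1)" "g \<in> Q 1" for g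
    proof -
      obtain u v where "u \<noteq> 0" "gram g = p_sgn (-1) u" "gram g = p_sgn 1 v"
        using Q(1)[OF g(1)] Q(1)[OF g(2)] by auto
      then have "p_sgn (-1) u = p_sgn 1 v" by simp
      then show False using \<open>u \<noteq> 0\<close> by (simp add: p_sgn_eq_iff)
    qed
    then show "Q (-1) \<inter> Q 1 = {}" by blast
    have False if g: "g \<in> R (-1)" "g \<in> R 1" for g
    proof -
      obtain u v where "u \<noteq> 0" "gram g = - p_sgn (-1) u" "gram g = - p_sgn 1 v"
        using R(1)[OF g(1)] R(1)[OF g(2)] by auto
      then have "p_sgn (-1) u = p_sgn 1 v" by (metis minus_minus)
      then show False using \<open>u \<noteq> 0\<close> by (simp add: p_sgn_eq_iff)
    qed
    then show "R (-1) \<inter> R 1 = {}" by blast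
  qed
  have sub: "KAK \<subseteq> SL2C" "Q 1 \<subseteq> SL2C" "Q (-1) \<subseteq> SL2C" "R 1 \<subseteq> SL2C" "R (-1) \<subseteq> SL2C"
    using KAK_gram(1)[folded KAK_def] Q(2)[of _ 1] Q(2)[of _ "-1"] R(2)[of _ 1] R(2)[of _ "-1"]
    unfolding SL2C_def by blast+
  have cover: "SL2C \<subseteq> KAK \<union> Q 1 \<union> Q (-1) \<union> R 1 \<union> R (-1)"
    using SL2C_decomposition[folded KAK_def Q_def R_def] unfolding SL2C_def by blast
  have Xi: "Xi_tilde \<subseteq> SL2C" "Xi_tilde \<inter> R 1 = {}" "Xi_tilde \<inter> R (-1) = {}"
    using Xi_tilde_iff Xi_tilde_gram_neq R(1)[of _ 1] R(1)[of _ "-1"] unfolding SL2C_def by blast+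
  \<comment> \<open>By \<open>KA'K_eq\<close> the first entry is the double coset of
    \<open>A_C'\<close>; in this form its disjointness from \<open>K_C\<close> is immediate.\<close>
  let ?Xs = "[KAK - K_C, Q (-1), Q 1, R (-1), R 1, K_C]"
  have "is_disjoint_union SL2C ?Xs"
    unfolding is_disjoint_union_def
  proof
    show "SL2C = \<Union>(set ?Xs)" using sub cover K by auto
    show "disjoint_family_on ((!) ?Xs) {..<length ?Xs}"
      unfolding disjoint_family_on_nth_Cons
      using disj[of 1 1] disj[of 1 "-1"] disj[of "-1" 1] disj[of "-1" "-1"] disj' K
      by (auto simp: disjoint_family_on_def)
  qed
  moreover have "\<forall>X\<in>set ?Xs. K_biinvariant X"
    using K_biinvariant_KAK[of A_C', unfolded KA'K_eq, folded KAK_def]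
      K_biinvariant_PK[folded Q_def] K_biinvariant_Py0K[folded R_def] K_biinvariant_K_C
    by simp
  \<comment> \<open>Inside the tube the cover loses \<open>KAK\<close> and both \<open>y0\<close>
    families. The two remaining intersections are identified with the cosets of the punctured discs
    by \<open>P_half_cosets\<close> below.\<close>
  moreover have "is_disjoint_union (Xi_tilde - KAK) [Xi_tilde \<inter> Q (-1), Xi_tilde \<inter> Q 1]"
    unfolding is_disjoint_union_def
  proof
    show "Xi_tilde - KAK = \<Union>(set [Xi_tilde \<inter> Q (-1), Xi_tilde \<inter> Q 1])"
      using Xi cover disj(1)[of 1 1] disj(1)[of "-1" 1] by auto
    show "disjoint_family_on ((!) [Xi_tilde \<inter> Q (-1), Xi_tilde \<inter> Q 1])
        {..<length [Xi_tilde \<inter> Q (-1), Xi_tilde \<inter> Q 1]}"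
      unfolding disjoint_family_on_nth_Cons
      using disj' by (auto simp: disjoint_family_on_def)
  qed
  moreover have "P_minus_half \<otimes>\<^sub>S K_C = Xi_tilde \<inter> Q (-1)" "P_plus_half \<otimes>\<^sub>S K_C = Xi_tilde \<inter> Q 1"
    unfolding P_half_eq Q_def by (rule P_half_cosets; simp)+
  ultimately show ?thesis
    by (simp only: Let_def KA'K_eq P_minus'_eq P_plus'_eq simp_thms
        KAK_def[symmetric] Q_def[symmetric] R_def[symmetric])
qed

end
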